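(* For every odd $k\ge3$, $\alpha(k\mathrm{AND})=\alpha'_k$, and for every even $k\ge2$, $\alpha(k\mathrm{AND})=2\alpha'_{k+1}$, where $\alpha'_k=\left(\frac{(k-1)(k+1)}{4k^2}\right)^{(k-1)/2}$.
   Context: For $\mathbf a\in\mathbb Z_2^k$, $\|\mathbf a\|_0$ is its Hamming weight. $k\mathrm{AND}:\mathbb Z_2^k\to\{0,1\}$ is $k\mathrm{AND}(\mathbf a)=\prod_{i}a_i$. $\mathcal B_p$ is the distribution on $\{0,1\}$ giving $0$ probability $p$ and $1$ probability $1-p$; $\mathcal B_p^k$ is its $k$-fold product. For a predicate $f:\mathbb Z_2^k\to\{0,1\}$, a distribution $\mathcal D$ on $\mathbb Z_2^k$ and $p\in[0,1]$, define $\lambda_f(\mathcal D,p)=\mathbb E_{\mathbf b\sim\mathcal D,\mathbf a\sim\mathcal B_p^k}[f(\mathbf a+\mathbf b)]$ (addition mod 2), $\gamma_f(\mathcal D)=\lambda_f(\mathcal D,1)=\mathbb E_{\mathbf b\sim\mathcal D}[f(\mathbf b)]$, and $\beta_f(\mathcal D)=\sup_{p\in[0,1]}\lambda_f(\mathcal D,p)$. The marginal vector $\boldsymbol\mu(\mathcal D)\in[-1,1]^k$ has entries $\mu(\mathcal D)_i=-\mathbb E_{\mathbf a\sim\mathcal D}[(-1)^{a_i}]$. Define $\alpha(f)=\inf\{\beta_f(\mathcal D_N)/\gamma_f(\mathcal D_Y)\}$ over all pairs of distributions $\mathcal D_N,\mathcal D_Y$ on $\mathbb Z_2^k$ with $\boldsymbol\mu(\mathcal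 D_N)=\boldsymbol\mu(\mathcal D_Y)$ (ratios with zero denominator read as $+\infty$). (By prior work this is the optimal approximation ratio for $\sqrt n$-space sketching algorithms for the Boolean CSP with predicate $f$ and negations, but the claim concerns only the quantity $\alpha(f)$.) *)

theory Defs
  imports "HOL-Analysis.Analysis" "HOL-Probability.Probability" "HOL-Library.Z2"
begin

text \<open>
  \<open>Z_2^k\<close> is the type \<open>bit ^ 'k\<close> with \<open>k = CARD('k)\<close>; its addition is componentwise addition
  mod 2. A predicate \<open>f : Z_2^k \<rightarrow> {0, 1}\<close> is \<open>bit\<close>-valued and is embedded into the reals
  by \<open>of_bit\<close>.
\<close>

definition kAND :: "bit ^ 'k::finite \<Rightarrow> bit" where
  "kAND a = (\<Prod>i\<in>UNIV. a $ i)"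

text \<open>The parameter \<open>p\<close> is the probability of \<open>0\<close>, hence \<open>1 - p\<close> for \<^const>\<open>bernoulli_pmf\<close>.\<close>

definition bias_pmf :: "real \<Rightarrow> bit pmf" where
  "bias_pmf p = map_pmf of_bool (bernoulli_pmf (1 - p))"

text \<open>The default value of \<^const>\<open>Pi_pmf\<close> is irrelevant, since the index set is the whole type.\<close>

definition bias_vec_pmf :: "real \<Rightarrow> (bit ^ 'k::finite) pmf" where
  "bias_vec_pmf p = map_pmf vec_lambda (Pi_pmf UNIV 0 (\<lambda>_. bias_pmf p))"

definition csp_lambda ::
    "(bit ^ 'k::finite \<Rightarrow> bit) \<Rightarrow> (bit ^ 'k) pmf \<Rightarrow> real \<Rightarrow> real" where
  "csp_lambda f D p =
     measure_pmf.expectation (pair_pmf D (bias_vec_pmf p)) (\<lambda>(b, a). of_bit (f (a + b)))"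

definition csp_gamma :: "(bit ^ 'k::finite \<Rightarrow> bit) \<Rightarrow> (bit ^ 'k) pmf \<Rightarrow> real" where
  "csp_gamma f D = csp_lambda f D 1"

definition csp_beta :: "(bit ^ 'k::finite \<Rightarrow> bit) \<Rightarrow> (bit ^ 'k) pmf \<Rightarrow> real" where
  "csp_beta f D = (SUP p\<in>{0..1}. csp_lambda f D p)"

definition marginal_vec :: "(bit ^ 'k::finite) pmf \<Rightarrow> real ^ 'k" where
  "marginal_vec D = (\<chi> i. - measure_pmf.expectation D (\<lambda>a. (- 1) ^ of_bit (a $ i)))"

text \<open>The infimum is taken in \<open>ereal\<close>, so that ratios with zero denominator are \<open>\<infinity>\<close>.\<close>

definition csp_alpha :: "(bit ^ 'k::finite \<Rightarrow> bit) \<Rightarrow> ereal" where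
  "csp_alpha f =
     Inf {if csp_gamma f DY = 0 then \<infinity> else ereal (csp_beta f DN / csp_gamma f DY) | DN DY.
            marginal_vec DN = marginal_vec DY}"

definition alpha' :: "nat \<Rightarrow> real" where
  "alpha' k =
     ((real k - 1) * (real k + 1) / (4 * (real k)\<^sup>2)) powr ((real k - 1) / 2)"

lemma pmf_bias_0: "0 \<le> p \<Longrightarrow> p \<le> 1 \<Longrightarrow> pmf (bias_pmf p) 0 = p"
proof -
  assume p: "0 \<le> p" "p \<le> 1"
  have "inj (of_bool :: bool \<Rightarrow> bit)"
    by (auto simp: inj_on_def)
  from pmf_map_inj'[OF this, of "bernoulli_pmf (1 - p)" False] p show ?thesis
    by (simp add: bias_pmf_def)
qed

lemma csp_gamma_eq_expectation:
  "csp_gamma f D = measure_pmf.expectation D (\<lambda>b. of_bit (f b))"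
proof -
  have "pmf (bernoulli_pmf 0) = pmf (return_pmf False)"
    by (rule ext) (case_tac x, auto)
  then have "bernoulli_pmf 0 = return_pmf False"
    by (simp add: pmf_eq_iff)
  then have "bias_pmf 1 = return_pmf 0"
    by (simp add: bias_pmf_def)
  moreover have "vec_lambda (\<lambda>_. 0) = (0 :: bit ^ 'a)"
    by (simp add: vec_eq_iff)
  ultimately have "bias_vec_pmf 1 = (return_pmf 0 :: (bit ^ 'a) pmf)"
    by (simp add: bias_vec_pmf_def Pi_pmf_return_pmf)
  then show ?thesis
    by (simp add: csp_gamma_def csp_lambda_def pair_return_pmf2 case_prod_beta)
qed

end

theory Submission
  imports Defs
begin

text \<open>
  Write \<open>|b|\<close> for the Hamming weight of \<open>b\<close>. Then \<open>\<lambda>(D, q)\<close> is the expectation of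
  \<open>q^|b| (1 - q)^(k - |b|)\<close>, while \<open>\<gamma>(D\<^sub>Y)\<close> is at most every marginal of \<open>D\<^sub>Y\<close>, hence
  at most the expectation of \<open>|b| / k\<close> under \<open>D\<^sub>N\<close>. Put \<open>m = \<lfloor>k / 2\<rfloor>\<close> and
  \<open>p = (m + 1) / (2m + 1)\<close>. Bernoulli's inequality gives
  \<open>c i / k \<le> p^i (1 - p)^(k - i)\<close> for all \<open>i\<close>, with equality for \<open>i \<in> {m, m + 1}\<close>, where \<open>c\<close>
  is the claimed value; this is the lower bound. It is attained by a symmetric \<open>D\<^sub>N\<close> on the
  weights \<open>m\<close> and \<open>m + 1\<close> whose \<open>\<lambda>(D\<^sub>N, q)\<close> is maximal at \<open>q = p\<close>, and by a \<open>D\<^sub>Y\<close>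
  supported on the all-zeros and the all-ones vector.
\<close>

section \<open>Expectations over bit vectors\<close>

definition weight :: "bit ^ 'k::finite \<Rightarrow> nat" where
  "weight b = card {i. b $ i = 1}"

definition marginal :: "(bit ^ 'k::finite) pmf \<Rightarrow> 'k \<Rightarrow> real" where
  "marginal D i = measure_pmf.expectation D (\<lambda>b. of_bit (b $ i))"

text \<open>A bit vector is the indicator of a set of coordinates. Finiteness makes every real
  function on bit vectors integrable, so no later expectation needs a separate argument.\<close>

lemma finite_bit_vec [simp, intro]: "finite (A :: (bit ^ 'k::finite) set)"
proof -
  have "b \<in> range (\<lambda>S. \<chi> i. of_bool (i \<in> S))" for b :: "bit ^ 'k"
    by (rule image_eqI[of _ _ "{i. b $ i = 1}"]) (auto simp: vec_eq_iff)
  then have "(UNIV :: (bit ^ 'k) set) \<subseteq> range (\<lambda>S. \<chi> i. of_bool (i \<in> S))"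
    by blast
  then have "finite (UNIV :: (bit ^ 'k) set)"
    by (rule finite_subset) simp
  then show ?thesis
    by (rule rev_finite_subset) simp
qed

lemma integrable_bit_vec [simp, intro]:
  fixes f :: "bit ^ 'k::finite \<Rightarrow> real"
  shows "integrable (measure_pmf D) f"
  by (rule integrable_measure_pmf_finite) simp

lemma weight_le: "weight (b :: bit ^ 'k::finite) \<le> CARD('k)"
  unfolding weight_def by (rule card_mono) auto

lemma sum_of_bit: "(\<Sum>i\<in>UNIV. of_bit (b $ i)) = real (weight b)"
proof -
  have "(\<Sum>i\<in>UNIV. of_bit (b $ i) :: real) = (\<Sum>i\<in>{i. b $ i = 1}. 1)"
    by (rule sum.mono_neutral_cong_right) auto
  then show ?thesis
    by (simp add: weight_def)
qed

lemma sum_marginal: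
  "(\<Sum>i\<in>UNIV. marginal D i) = measure_pmf.expectation D (\<lambda>b. real (weight b))"
  unfolding marginal_def
  by (subst Bochner_Integration.integral_sum[symmetric]) (simp_all only: sum_of_bit integrable_bit_vec)

text \<open>Since -(-1)^x = 2x - 1 for a bit x, each entry of \<open>marginal_vec\<close> is an
  injective affine function of the probability that the coordinate is 1.\<close>

lemma marginal_vec_eq_iff:
  fixes D D' :: "(bit ^ 'k::finite) pmf"
  shows "marginal_vec D = marginal_vec D' \<longleftrightarrow> (\<forall>i. marginal D i = marginal D' i)"
proof -
  have E: "- measure_pmf.expectation D (\<lambda>a. (- 1) ^ of_bit (a $ i) :: real) = 2 * marginal D i - 1"
    for D :: "(bit ^ 'k) pmf" and i
  proof -
    have "- measure_pmf.expectation D (\<lambda>a. (- 1) ^ of_bit (a $ i)) =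
        measure_pmf.expectation D (\<lambda>a. - ((- 1) ^ of_bit (a $ i)) :: real)"
      by simp
    also have "\<dots> = measure_pmf.expectation D (\<lambda>a. 2 * of_bit (a $ i) - 1)"
      by (rule Bochner_Integration.integral_cong) auto
    also have "\<dots> = 2 * marginal D i - 1"
      by (simp add: marginal_def)
    finally show ?thesis .
  qed
  show ?thesis
    unfolding marginal_vec_def vec_eq_iff vec_lambda_beta E by simp
qed

lemma of_bit_kAND: "(of_bit (kAND a) :: real) = (\<Prod>i\<in>UNIV. of_bit (a $ i))"
proof -
  have "(of_bit (\<Prod>i\<in>S. a $ i) :: real) = (\<Prod>i\<in>S. of_bit (a $ i))" if "finite S" for S
    using that by induction auto
  then show ?thesis
    by (simp add: kAND_def)
qed

text \<open>A conjunction is pointwise at most each of its conjuncts.\<close>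

lemma csp_gamma_le_marginal: "csp_gamma kAND D \<le> marginal D i"
  unfolding csp_gamma_eq_expectation marginal_def
proof (rule integral_mono)
  fix b :: "bit ^ 'a"
  show "of_bit (kAND b) \<le> (of_bit (b $ i) :: real)"
    by (cases "b $ i") (auto simp: kAND_def intro: prod_zero)
qed simp_all

lemma csp_gamma_nonneg: "0 \<le> csp_gamma f D"
  unfolding csp_gamma_eq_expectation by (rule integral_nonneg_AE) simp

text \<open>The noise bits are independent, so the expectation of the product factors. Coordinate i
  of \<open>a + b\<close> is 1 iff the noise bit differs from \<open>b $ i\<close>; as
  \<open>q\<close> is the probability of noise 0, this has probability \<open>q\<close> when
  \<open>b $ i = 1\<close> and \<open>1 - q\<close> otherwise.\<close>

lemma expectation_bias_vec:
  fixes b :: "bit ^ 'k::finite"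
  assumes q: "q \<in> {0..1}"
  shows "measure_pmf.expectation (bias_vec_pmf q) (\<lambda>a. of_bit (kAND (a + b))) =
    q ^ weight b * (1 - q) ^ (CARD('k) - weight b)"
proof -
  have "measure_pmf.expectation (bias_vec_pmf q) (\<lambda>a. of_bit (kAND (a + b))) =
    measure_pmf.expectation (Pi_pmf UNIV 0 (\<lambda>_. bias_pmf q))
      (\<lambda>a. \<Prod>i\<in>UNIV. (of_bit (a i + b $ i) :: real))"
    unfolding of_bit_kAND bias_vec_pmf_def by simp
  also have "\<dots> = (\<Prod>i\<in>UNIV. measure_pmf.expectation (bias_pmf q) (\<lambda>x. of_bit (x + b $ i)))"
    by (rule expectation_prod_Pi_pmf) (auto simp: bias_pmf_def intro!: integrable_measure_pmf_finite)
  also have "\<dots> = (\<Prod>i\<in>UNIV. if b $ i = 1 then q else 1 - q)"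
  proof (rule prod.cong[OF refl])
    fix i
    show "measure_pmf.expectation (bias_pmf q) (\<lambda>x. of_bit (x + b $ i)) =
        (if b $ i = 1 then q else 1 - q)"
      using q by (cases "b $ i") (auto simp: bias_pmf_def)
  qed
  also have "\<dots> = q ^ weight b * (1 - q) ^ card {i. b $ i \<noteq> 1}"
    by (simp add: prod.If_cases weight_def Compl_eq)
  also have "card {i. b $ i \<noteq> 1} = CARD('k) - weight b"
    unfolding weight_def by (subst card_Diff_subset[symmetric]) (auto intro: arg_cong[of _ _ card])
  finally show ?thesis .
qed

text \<open>Conditioning on \<open>b\<close> leaves a function of its weight alone, so only the
  weight distribution of \<open>D\<close> matters for \<lambda> and \<beta>.\<close>

lemma csp_lambda_kAND:
  fixes D :: "(bit ^ 'k::finite) pmf"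
  assumes q: "q \<in> {0..1}"
  shows "csp_lambda kAND D q =
    measure_pmf.expectation D (\<lambda>b. q ^ weight b * (1 - q) ^ (CARD('k) - weight b))"
proof -
  have "csp_lambda kAND D q =
    measure_pmf.expectation (D \<bind> (\<lambda>b. map_pmf (Pair b) (bias_vec_pmf q)))
      (\<lambda>(b, a). of_bit (kAND (a + b)))"
    unfolding csp_lambda_def pair_pmf_def map_pmf_def by (simp add: add.commute)
  also have "\<dots> = (\<Sum>b\<in>UNIV. pmf D b *\<^sub>R
      measure_pmf.expectation (bias_vec_pmf q) (\<lambda>a. of_bit (kAND (a + b))))"
    by (subst pmf_expectation_bind[of UNIV]) simp_all
  also have "\<dots> = (\<Sum>b\<in>UNIV. pmf D b *\<^sub>R (q ^ weight b * (1 - q) ^ (CARD('k) - weight b)))"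
    by (simp only: expectation_bias_vec[OF q])
  also have "\<dots> = measure_pmf.expectation D (\<lambda>b. q ^ weight b * (1 - q) ^ (CARD('k) - weight b))"
    by (rule integral_measure_pmf[symmetric]) simp_all
  finally show ?thesis .
qed

lemma csp_lambda_le_beta:
  fixes D :: "(bit ^ 'k::finite) pmf"
  assumes "q \<in> {0..1}"
  shows "csp_lambda kAND D q \<le> csp_beta kAND D"
  unfolding csp_beta_def
proof (rule cSUP_upper[OF assms])
  \<comment> \<open>The real supremum is an upper bound only for a bounded family; here the
    integrand is a product of powers of numbers in [0,1].\<close>
  show "bdd_above (csp_lambda kAND D ` {0..1})"
  proof (rule bdd_aboveI2)
    fix r :: real assume r: "r \<in> {0..1}"
    have "csp_lambda kAND D r \<le> measure_pmf.expectation D (\<lambda>_. 1)"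
      unfolding csp_lambda_kAND[OF r] using r
      by (intro integral_mono) (auto intro!: mult_le_one power_le_one)
    then show "csp_lambda kAND D r \<le> 1"
      by simp
  qed
qed

section \<open>Bounds for the approximation ratio\<close>

text \<open>Weak duality: a single bias \<open>p\<close> whose acceptance probability dominates a
  multiple of the weight serves against every pair of distributions.\<close>

lemma csp_alpha_kAND_ge:
  assumes p: "p \<in> {0..1}"
    and c: "\<And>i. i \<le> CARD('k::finite) \<Longrightarrow> c * real i / CARD('k) \<le> p ^ i * (1 - p) ^ (CARD('k) - i)"
    and c0: "0 \<le> c"
  shows "ereal c \<le> csp_alpha (kAND :: bit ^ 'k \<Rightarrow> bit)"
proof -
  have "c \<le> csp_beta kAND DN / csp_gamma kAND DY"
    if eq: "marginal_vec DN = marginal_vec DY" and ne: "csp_gamma kAND DY \<noteq> 0"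
    for DN DY :: "(bit ^ 'k) pmf"
  proof -
    \<comment> \<open>Averaging the marginal bounds over all coordinates turns them into a bound by
      the mean weight, which carries over from \<open>DY\<close> to \<open>DN\<close>.\<close>
    have "CARD('k) * csp_gamma kAND DY = (\<Sum>i\<in>(UNIV :: 'k set). csp_gamma kAND DY)"
      by simp
    also have "\<dots> \<le> (\<Sum>i\<in>UNIV. marginal DY i)"
      by (intro sum_mono csp_gamma_le_marginal)
    also have "\<dots> = (\<Sum>i\<in>UNIV. marginal DN i)"
      using eq by (simp add: marginal_vec_eq_iff)
    also have "\<dots> = measure_pmf.expectation DN (\<lambda>b. real (weight b))"
      by (rule sum_marginal)
    finally have "csp_gamma kAND DY \<le> measure_pmf.expectation DN (\<lambda>b. real (weight b)) / CARD('k)"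
      by (simp add: field_simps)
    then have "c * csp_gamma kAND DY \<le> c * (measure_pmf.expectation DN (\<lambda>b. real (weight b)) / CARD('k))"
      using c0 by (rule mult_left_mono)
    also have "\<dots> = measure_pmf.expectation DN (\<lambda>b. c * real (weight b) / CARD('k))"
      by simp
    also have "\<dots> \<le> csp_lambda kAND DN p"
      unfolding csp_lambda_kAND[OF p] by (intro integral_mono integrable_bit_vec c weight_le)
    also have "\<dots> \<le> csp_beta kAND DN"
      by (rule csp_lambda_le_beta[OF p])
    finally show ?thesis
      using ne csp_gamma_nonneg[of kAND DY] by (simp add: field_simps)
  qed
  then show ?thesis
    unfolding csp_alpha_def by (intro Inf_greatest) auto
qed

text \<open>Draw a weight from \<open>W\<close>, then a uniform vector of that weight. This is
  meaningful only if no weight in the support exceeds the dimension: otherwise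
  \<open>pmf_of_set\<close> is applied to the empty set.\<close>

definition symmetric_pmf :: "nat pmf \<Rightarrow> (bit ^ 'k::finite) pmf" where
  "symmetric_pmf W = W \<bind> (\<lambda>i. pmf_of_set {b. weight b = i})"

lemma ex_weight:
  assumes "i \<le> CARD('k::finite)"
  shows "\<exists>b :: bit ^ 'k. weight b = i"
proof -
  obtain S :: "'k set" where "card S = i"
    using obtain_subset_with_card_n[OF assms] by blast
  then have "weight (\<chi> j. of_bool (j \<in> S) :: bit ^ 'k) = i"
    by (simp add: weight_def)
  then show ?thesis ..
qed

lemma map_weight_symmetric_pmf:
  assumes "set_pmf W \<subseteq> {..CARD('k::finite)}"
  shows "map_pmf weight (symmetric_pmf W :: (bit ^ 'k) pmf) = W"
proof -
  have "map_pmf weight (symmetric_pmf W :: (bit ^ 'k) pmf) =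
      W \<bind> (\<lambda>i. map_pmf weight (pmf_of_set {b :: bit ^ 'k. weight b = i}))"
    by (simp add: symmetric_pmf_def map_bind_pmf)
  also have "\<dots> = W \<bind> return_pmf"
  proof (rule bind_pmf_cong[OF refl])
    fix i assume "i \<in> set_pmf W"
    then have "{b :: bit ^ 'k. weight b = i} \<noteq> {}"
      using assms ex_weight[where 'k='k, of i] by blast
    then have "map_pmf weight (pmf_of_set {b :: bit ^ 'k. weight b = i}) =
        map_pmf (\<lambda>_. i) (pmf_of_set {b :: bit ^ 'k. weight b = i})"
      by (intro map_pmf_cong) (auto simp: set_pmf_of_set)
    then show "map_pmf weight (pmf_of_set {b :: bit ^ 'k. weight b = i}) = return_pmf i"
      by (simp add: map_pmf_const)
  qed
  finally show ?thesis
    by (simp add: bind_return_pmf')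
qed

lemma expectation_weight_symmetric_pmf:
  fixes g :: "nat \<Rightarrow> real"
  assumes "set_pmf W \<subseteq> {..CARD('k::finite)}"
  shows "measure_pmf.expectation (symmetric_pmf W :: (bit ^ 'k) pmf) (\<lambda>b. g (weight b)) =
    measure_pmf.expectation W g"
  using integral_map_pmf[of weight "symmetric_pmf W :: (bit ^ 'k) pmf" g]
  by (simp add: map_weight_symmetric_pmf[OF assms])

text \<open>Swapping coordinates \<open>i\<close> and \<open>j\<close> is a weight-preserving
  involution, so it permutes each weight class and fixes the distribution.\<close>

lemma marginal_symmetric_pmf_eq:
  assumes "set_pmf W \<subseteq> {..CARD('k::finite)}"
  shows "marginal (symmetric_pmf W) (i :: 'k) = marginal (symmetric_pmf W) (j :: 'k)"
proof -
  define T where "T = (\<lambda>b :: bit ^ 'k. \<chi> l. b $ Transposition.transpose i j l)"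
  have TT: "T (T b) = b" for b
    by (simp add: T_def vec_eq_iff)
  have wT: "weight (T b) = weight b" for b
  proof -
    have "{l. T b $ l = 1} = Transposition.transpose i j ` {l. b $ l = 1}"
      by (force simp: T_def image_iff intro: exI[of _ "Transposition.transpose i j _"])
    then show ?thesis
      unfolding weight_def by (simp add: card_image inj_on_subset[OF inj_transpose])
  qed
  have "map_pmf T (pmf_of_set {b. weight b = n}) = pmf_of_set {b. weight b = n}"
    if "n \<in> set_pmf W" for n
  proof (rule map_pmf_of_set_bij_betw)
    show "bij_betw T {b. weight b = n} {b. weight b = n}"
      by (rule bij_betwI[where g = T]) (auto simp: TT wT)
    show "{b :: bit ^ 'k. weight b = n} \<noteq> {}"
      using that assms ex_weight[where 'k='k, of n] by blast
  qed simp
  then have map_T: "map_pmf T (symmetric_pmf W) = symmetric_pmf W"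
    unfolding symmetric_pmf_def map_bind_pmf by (intro bind_pmf_cong refl)
  have "marginal (symmetric_pmf W) i = marginal (map_pmf T (symmetric_pmf W)) i"
    by (simp only: map_T)
  also have "\<dots> = marginal (symmetric_pmf W) j"
    by (simp add: marginal_def T_def)
  finally show ?thesis .
qed

lemma marginal_symmetric_pmf:
  assumes "set_pmf W \<subseteq> {..CARD('k::finite)}"
  shows "marginal (symmetric_pmf W) (i :: 'k) = measure_pmf.expectation W real / CARD('k)"
proof -
  have "CARD('k) * marginal (symmetric_pmf W) i = (\<Sum>j\<in>(UNIV :: 'k set). marginal (symmetric_pmf W) i)"
    by simp
  also have "\<dots> = (\<Sum>j\<in>(UNIV :: 'k set). marginal (symmetric_pmf W) j)"
    by (rule sum.cong[OF refl]) (rule marginal_symmetric_pmf_eq[OF assms])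
  also have "\<dots> = measure_pmf.expectation W real"
    unfolding sum_marginal by (rule expectation_weight_symmetric_pmf[OF assms])
  finally show ?thesis
    by (simp add: field_simps)
qed

text \<open>The complementary slackness counterpart of \<open>csp_alpha_kAND_ge\<close>: if
  \<open>W\<close> lives on weights where the dual inequality is tight and \<open>p\<close> is an
  optimal bias for \<open>W\<close>, every inequality of the lower bound becomes an
  equality.\<close>

lemma csp_alpha_kAND_le:
  assumes p: "p \<in> {0..1}"
    and W: "set_pmf W \<subseteq> {..CARD('k::finite)}" "measure_pmf.expectation W real > 0"
    and tight: "\<And>i. i \<in> set_pmf W \<Longrightarrow>
      p ^ i * (1 - p) ^ (CARD('k) - i) = c * real i / CARD('k)"
    and opt: "\<And>q. q \<in> {0..1} \<Longrightarrow>
      measure_pmf.expectation W (\<lambda>i. q ^ i * (1 - q) ^ (CARD('k) - i)) \<le>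
      measure_pmf.expectation W (\<lambda>i. p ^ i * (1 - p) ^ (CARD('k) - i))"
  shows "csp_alpha (kAND :: bit ^ 'k \<Rightarrow> bit) \<le> ereal c"
proof -
  \<comment> \<open>\<open>s\<close> is the common marginal of the symmetric distribution. Making
    all bits of \<open>DY\<close> equal gives it the same marginals and raises its \<gamma> to
    \<open>s\<close>, the largest value these marginals allow.\<close>
  define s where "s = measure_pmf.expectation W real / CARD('k)"
  define DN :: "(bit ^ 'k) pmf" where "DN = symmetric_pmf W"
  define DY :: "(bit ^ 'k) pmf" where "DY = map_pmf (\<lambda>x. \<chi> _. of_bool x) (bernoulli_pmf s)"
  have finW: "finite (set_pmf W)"
    using W(1) by (rule finite_subset) simp
  \<comment> \<open>The bound \<open>s \<le> 1\<close> makes \<open>s\<close> a genuine Bernoulli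
    parameter; positivity keeps the ratio finite.\<close>
  have "measure_pmf.expectation W real \<le> measure_pmf.expectation W (\<lambda>_. CARD('k))"
    using W(1) by (intro integral_mono_AE integrable_measure_pmf_finite finW) (auto simp: AE_measure_pmf_iff)
  with W(2) have s: "0 < s" "s \<le> 1"
    by (simp_all add: s_def)
  have gamma: "csp_gamma kAND DY = s"
    unfolding csp_gamma_eq_expectation DY_def of_bit_kAND using s by simp
  have "marginal DY i = s" for i
    unfolding marginal_def DY_def using s by simp
  then have marg: "marginal_vec DN = marginal_vec DY"
    by (simp add: marginal_vec_eq_iff DN_def marginal_symmetric_pmf[OF W(1)] s_def)
  have lambda: "csp_lambda kAND DN q =
      measure_pmf.expectation W (\<lambda>i. q ^ i * (1 - q) ^ (CARD('k) - i))" if "q \<in> {0..1}" for q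
    unfolding csp_lambda_kAND[OF that] DN_def by (rule expectation_weight_symmetric_pmf[OF W(1)])
  have "csp_beta kAND DN \<le> csp_lambda kAND DN p"
    unfolding csp_beta_def
  proof (rule cSUP_least)
    fix q :: real assume "q \<in> {0..1}"
    then show "csp_lambda kAND DN q \<le> csp_lambda kAND DN p"
      by (simp only: lambda p(1) opt)
  qed simp
  also have "\<dots> = measure_pmf.expectation W (\<lambda>i. c * real i / CARD('k))"
    unfolding lambda[OF p] by (intro integral_cong_AE) (auto simp: AE_measure_pmf_iff tight)
  also have "\<dots> = c * s"
    by (simp add: s_def)
  finally have "csp_beta kAND DN / csp_gamma kAND DY \<le> c"
    using s by (simp add: gamma field_simps)
  moreover have "csp_alpha (kAND :: bit ^ 'k \<Rightarrow> bit) \<le> ereal (csp_beta kAND DN / csp_gamma kAND DY)"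
    unfolding csp_alpha_def
    by (rule Inf_lower, rule CollectI, rule exI[of _ DN], rule exI[of _ DY]) (use marg gamma s in simp)
  ultimately show ?thesis
    using order_trans ereal_less_eq(3) by blast
qed

section \<open>The optimal bias\<close>

text \<open>Raising the weight by one multiplies the bias power by the odds p/(1 - p), and
  \<open>p\<close> is chosen to make these (m + 1)/m, the ratio of the two weights.\<close>

lemma tight_at_consecutive_weights:
  assumes m: "0 < m" "m < n" and p: "p = (real m + 1) / (2 * real m + 1)"
  shows "p ^ (m + 1) * (1 - p) ^ (n - (m + 1)) = (m + 1) * (p ^ m * (1 - p) ^ (n - m) / m)"
proof -
  have "(1 - p) ^ (n - m) = (1 - p) * (1 - p) ^ (n - (m + 1))"
    using m by (metis Suc_diff_Suc Suc_eq_plus1 power_Suc)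
  moreover have "p ^ (m + 1) * (1 - p) ^ (n - (m + 1)) * m = p * m * (p ^ m * (1 - p) ^ (n - (m + 1)))"
    by simp
  moreover have "p * m = (m + 1) * (1 - p)"
    unfolding p by (simp add: field_simps)
  ultimately have *: "p ^ (m + 1) * (1 - p) ^ (n - (m + 1)) * m = (m + 1) * (p ^ m * (1 - p) ^ (n - m))"
    by simp
  show ?thesis
    using eq_divide_imp[OF _ *] m(1) by simp
qed

text \<open>The exponential (1 + 1/m)^(i - m) is convex in i and meets the line i/m at i = m and i =
  m + 1, so at integers it never falls below the line. Bernoulli's inequality is used separately on
  the two sides of \<open>m\<close>.\<close>

lemma weight_le_odds_power:
  assumes m: "0 < m"
  shows "real i * (1 + 1 / real m) ^ m \<le> real m * (1 + 1 / real m) ^ i"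
proof (cases "m \<le> i")
  case True
  then obtain n where i: "i = m + n"
    using le_Suc_ex by blast
  have "1 + real n * (1 / real m) \<le> (1 + 1 / real m) ^ n"
    by (rule Bernoulli_inequality) (simp add: order_trans[of _ 0])
  then have "real i \<le> real m * (1 + 1 / real m) ^ n"
    using m by (simp add: i field_simps)
  then have "real i * (1 + 1 / real m) ^ m \<le> real m * (1 + 1 / real m) ^ n * (1 + 1 / real m) ^ m"
    by (rule mult_right_mono) simp
  then show ?thesis
    by (simp add: i power_add mult_ac)
next
  case False
  then obtain n where n: "m = i + n"
    using le_Suc_ex nat_le_linear by blast
  \<comment> \<open>\<open>r\<close> is the reciprocal of 1 + 1/m, so descending from weight m is
    again a power with a positive exponent.\<close>
  define r where "r = 1 - 1 / (real m + 1)"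
  have "1 + real n * (- 1 / (real m + 1)) \<le> (1 + (- 1 / (real m + 1))) ^ n"
    using m by (intro Bernoulli_inequality) (simp add: field_simps)
  then have "1 - real n / (real m + 1) \<le> r ^ n"
    by (simp add: r_def)
  moreover have "real n / (real m + 1) \<le> real n / real m"
    using m by (intro divide_left_mono) auto
  moreover have "real i / real m = 1 - real n / real m"
    using m by (simp add: field_simps) (simp add: n)
  ultimately have "real i / real m \<le> r ^ n"
    by linarith
  then have "real i \<le> real m * r ^ n"
    using m by (simp add: field_simps)
  then have "real i * (1 + 1 / real m) ^ n \<le> real m * r ^ n * (1 + 1 / real m) ^ n"
    by (rule mult_right_mono) simp
  also have "\<dots> = real m * (r * (1 + 1 / real m)) ^ n"
    by (simp only: power_mult_distrib mult.assoc)
  also have "r * (1 + 1 / real m) = 1"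
  proof -
    have "r = real m / (real m + 1)" "1 + 1 / real m = (real m + 1) / real m"
      using m by (simp_all add: r_def field_simps)
    moreover have "real m + 1 \<noteq> 0"
      by linarith
    ultimately show ?thesis
      using m by simp
  qed
  finally have "real i * (1 + 1 / real m) ^ n \<le> real m"
    by simp
  then have "real i * (1 + 1 / real m) ^ n * (1 + 1 / real m) ^ i \<le> real m * (1 + 1 / real m) ^ i"
    by (rule mult_right_mono) simp
  then show ?thesis
    by (simp add: n power_add mult_ac)
qed

text \<open>Factoring out (1 - p)^n leaves powers of the odds p/(1 - p) = 1 + 1/m, which reduces the
  claim to \<open>weight_le_odds_power\<close>.\<close>

lemma weight_le_bias_power:
  assumes m: "0 < m" "m \<le> n" "i \<le> n" and p: "p = (real m + 1) / (2 * real m + 1)"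
  shows "real i * (p ^ m * (1 - p) ^ (n - m) / m) \<le> p ^ i * (1 - p) ^ (n - i)"
proof -
  have p1: "1 - p = real m / (2 * real m + 1)" "1 + 1 / real m = (real m + 1) / real m"
    unfolding p using m(1) by (simp_all add: field_simps)
  have p': "p = (1 - p) * (1 + 1 / real m)"
    unfolding p1 unfolding p using m(1) by simp
  have pos: "0 \<le> 1 - p"
    unfolding p1 by simp
  have *: "p ^ j * (1 - p) ^ (n - j) = (1 - p) ^ n * (1 + 1 / real m) ^ j" if "j \<le> n" for j
  proof -
    have "p ^ j = (1 - p) ^ j * (1 + 1 / real m) ^ j"
      by (subst p') (rule power_mult_distrib)
    moreover have "(1 - p) ^ j * (1 - p) ^ (n - j) = (1 - p) ^ n"
      using that by (simp flip: power_add)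
    ultimately show ?thesis
      by (simp add: mult_ac)
  qed
  have "(1 - p) ^ n * (real i * (1 + 1 / real m) ^ m) \<le> (1 - p) ^ n * (real m * (1 + 1 / real m) ^ i)"
    using weight_le_odds_power[OF m(1)] pos by (intro mult_left_mono) auto
  then have "real i * (p ^ m * (1 - p) ^ (n - m)) \<le> p ^ i * (1 - p) ^ (n - i) * real m"
    by (simp only: *[OF m(2)] *[OF m(3)] mult_ac)
  then show ?thesis
    using m(1) by (simp only: times_divide_eq_right pos_divide_le_eq of_nat_0_less_iff)
qed

text \<open>By \<open>1 + x \<le> exp x\<close> applied to each factor; the exponents cancel because \<open>p\<close> is a critical
  point.\<close>

lemma bias_power_max_odd:
  fixes q :: real
  assumes m: "0 < m" and q: "q \<in> {0..1}" and p: "p = (real m + 1) / (2 * real m + 1)"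
  shows "q ^ (m + 1) * (1 - q) ^ m \<le> p ^ (m + 1) * (1 - p) ^ m"
proof -
  have pp: "p > 0" "1 - p > 0"
    unfolding p using m by (simp_all add: field_simps)
  have "q / p \<le> exp (q / p - 1)" "(1 - q) / (1 - p) \<le> exp ((1 - q) / (1 - p) - 1)"
    using exp_ge_add_one_self[of "q / p - 1"] exp_ge_add_one_self[of "(1 - q) / (1 - p) - 1"] by simp_all
  then have "(q / p) ^ (m + 1) * ((1 - q) / (1 - p)) ^ m \<le>
      exp (q / p - 1) ^ (m + 1) * exp ((1 - q) / (1 - p) - 1) ^ m"
    using q pp by (intro mult_mono power_mono) auto
  also have "\<dots> = exp (real (m + 1) * (q / p - 1) + m * ((1 - q) / (1 - p) - 1))"
    by (simp only: exp_add exp_of_nat_mult)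
  also have "real (m + 1) * (q / p - 1) + m * ((1 - q) / (1 - p) - 1) = 0"
  proof -
    have "1 - p = m / (2 * real m + 1)"
      unfolding p by (simp add: field_simps)
    then show ?thesis
      unfolding p using m by (simp add: field_simps)
  qed
  finally show ?thesis
    using pp by (simp add: power_divide field_simps)
qed

text \<open>Up to a constant, this is the acceptance polynomial of a mixture of weights m and m + 1
  in dimension 2m: the linear factor is (m + 1)^2 (1 - q) + m^2 q. It is treated as a third factor
  in the exponential bound.\<close>

lemma bias_power_max_even:
  fixes q :: real
  assumes m: "0 < m" and q: "q \<in> {0..1}" and p: "p = (real m + 1) / (2 * real m + 1)"
  shows "q ^ m * (1 - q) ^ (m - 1) * ((real m + 1)\<^sup>2 - (2 * real m + 1) * q) \<le>
    p ^ m * (1 - p) ^ (m - 1) * ((real m + 1)\<^sup>2 - (2 * real m + 1) * p)"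
proof -
  define L where "L = (\<lambda>x. (real m + 1)\<^sup>2 - (2 * real m + 1) * x)"
  have pp: "p > 0" "1 - p > 0"
    unfolding p using m by (simp_all add: field_simps)
  have Lp: "L p = m * (real m + 1)"
    unfolding L_def p by (simp add: field_simps power2_eq_square)
  then have Lp0: "L p > 0"
    using m by simp
  have "(2 * real m + 1) * q \<le> (2 * real m + 1) * 1"
    using q by (intro mult_left_mono) auto
  \<comment> \<open>Nonnegativity of the linear factor is needed to multiply the three bounds; on
    [0,1] it is smallest at q = 1, with value m^2.\<close>
  then have "L q \<ge> (real m)\<^sup>2"
    by (simp add: L_def power2_eq_square algebra_simps)
  then have Lq: "L q \<ge> 0"
    by (rule order_trans[rotated]) simp
  have "q / p \<le> exp (q / p - 1)" "(1 - q) / (1 - p) \<le> exp ((1 - q) / (1 - p) - 1)"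
      "L q / L p \<le> exp (L q / L p - 1)"
    using exp_ge_add_one_self[of "q / p - 1"] exp_ge_add_one_self[of "(1 - q) / (1 - p) - 1"]
      exp_ge_add_one_self[of "L q / L p - 1"] by simp_all
  then have "(q / p) ^ m * ((1 - q) / (1 - p)) ^ (m - 1) * (L q / L p) \<le>
      exp (q / p - 1) ^ m * exp ((1 - q) / (1 - p) - 1) ^ (m - 1) * exp (L q / L p - 1)"
    using q pp Lq Lp0 by (intro mult_mono power_mono) auto
  also have "\<dots> = exp (m * (q / p - 1) + real (m - 1) * ((1 - q) / (1 - p) - 1) + (L q / L p - 1))"
    by (simp only: exp_add exp_of_nat_mult)
  also have "m * (q / p - 1) + real (m - 1) * ((1 - q) / (1 - p) - 1) + (L q / L p - 1) = 0"
  proof -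
    \<comment> \<open>\<open>d\<close> is a multiple of q - p. All three relative deviations are
      multiples of \<open>d\<close>, with coefficients 1/(m + 1), -1/m and -1/(m(m + 1)), and their
      weighted sum cancels.\<close>
    define d where "d = (2 * real m + 1) * q - (real m + 1)"
    have "1 - p = m / (2 * real m + 1)"
      unfolding p by (simp add: field_simps)
    then have "(1 - q) / (1 - p) - 1 = - d / m"
      using m by (simp only:) (simp add: d_def field_simps)
    moreover have "q / p - 1 = d / (real m + 1)"
      unfolding p d_def by (simp add: field_simps)
    moreover have "L q / L p - 1 = - d / (m * (real m + 1))"
    proof -
      have "L q - L p = - d"
        unfolding Lp by (simp add: L_def d_def power2_eq_square algebra_simps)
      moreover have "L q / L p - 1 = (L q - L p) / L p"
        using Lp0 by (simp add: diff_divide_distrib)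
      ultimately show ?thesis
        by (simp only: Lp)
    qed
    moreover have "real (m - 1) = real m - 1"
      using m by simp
    moreover have "x * (d / (x + 1)) + (x - 1) * (- d / x) + - d / (x * (x + 1)) = 0"
      if "x > 0" for x :: real
      using that by (simp add: divide_simps) (simp add: algebra_simps)
    ultimately show ?thesis
      using m by simp
  qed
  finally have "q ^ m * (1 - q) ^ (m - 1) * L q \<le> p ^ m * (1 - p) ^ (m - 1) * L p"
    using pp Lp0 by (simp add: power_divide field_simps)
  then show ?thesis
    by (simp only: L_def)
qed

text \<open>For k = 2m + 1 the base of the power is exactly p(1 - p); being positive, it allows
  \<open>powr\<close> to become an ordinary power.\<close>

lemma alpha'_odd:
  assumes m: "0 < m" and p: "p = (real m + 1) / (2 * real m + 1)"
  shows "alpha' (2 * m + 1) = p ^ m * (1 - p) ^ m"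
proof -
  have "alpha' (2 * m + 1) = (2 * real m * (2 * real m + 2) / (4 * (2 * real m + 1)\<^sup>2)) powr real m"
    by (simp add: alpha'_def add_ac)
  also have "2 * real m * (2 * real m + 2) / (4 * (2 * real m + 1)\<^sup>2) = p * (1 - p)"
    unfolding p by (simp add: divide_simps power2_eq_square)
  also have "(p * (1 - p)) powr real m = (p * (1 - p)) ^ m"
    using m by (intro powr_realpow mult_pos_pos) (simp_all add: p field_simps)
  finally show ?thesis
    by (simp add: power_mult_distrib)
qed

section \<open>The value of the approximation ratio\<close>

lemma csp_alpha_kAND_odd:
  assumes k: "CARD('k::finite) = 2 * m + 1" and m: "0 < m"
  shows "csp_alpha (kAND :: bit ^ 'k \<Rightarrow> bit) = ereal (alpha' CARD('k))"
proof (rule antisym)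
  define p where "p = (real m + 1) / (2 * real m + 1)"
  have p: "p \<in> {0..1}" "1 - p = m / (2 * real m + 1)"
    by (auto simp: p_def field_simps)
  have c: "alpha' CARD('k) = p ^ m * (1 - p) ^ m"
    unfolding k by (rule alpha'_odd[OF m p_def])
  \<comment> \<open>Since 1 - p = m/k here, the factor m/k supplies the missing power of 1 - p.
    Below, the redundant-looking \<open>* m / m\<close> matches the normalisation by the value at
    weight m.\<close>
  have ck: "alpha' CARD('k) / CARD('k) * m = p ^ m * (1 - p) ^ (CARD('k) - m)"
    unfolding c by (simp add: k p(2) add_ac)
  \<comment> \<open>A point mass suffices: \<open>p\<close> itself maximises q^(m + 1) (1 -
    q)^m.\<close>
  show "csp_alpha (kAND :: bit ^ 'k \<Rightarrow> bit) \<le> ereal (alpha' CARD('k))"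
  proof (rule csp_alpha_kAND_le[OF p(1), of "return_pmf (m + 1)"])
    fix i assume "i \<in> set_pmf (return_pmf (m + 1))"
    then have i: "i = m + 1" by simp
    have "p ^ i * (1 - p) ^ (CARD('k) - i) = (m + 1) * (alpha' CARD('k) / CARD('k) * m / m)"
      unfolding ck i using m by (intro tight_at_consecutive_weights p_def) (auto simp: k)
    then show "p ^ i * (1 - p) ^ (CARD('k) - i) = alpha' CARD('k) * real i / CARD('k)"
      using m by (simp add: i mult_ac)
  next
    fix q :: real assume "q \<in> {0..1}"
    then show "measure_pmf.expectation (return_pmf (m + 1)) (\<lambda>i. q ^ i * (1 - q) ^ (CARD('k) - i)) \<le>
        measure_pmf.expectation (return_pmf (m + 1)) (\<lambda>i. p ^ i * (1 - p) ^ (CARD('k) - i))"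
      using bias_power_max_odd[OF m _ p_def, of q] by (simp add: k)
  qed (simp_all add: k)
  show "ereal (alpha' CARD('k)) \<le> csp_alpha (kAND :: bit ^ 'k \<Rightarrow> bit)"
  proof (rule csp_alpha_kAND_ge[OF p(1)])
    fix i assume "i \<le> CARD('k)"
    then have "real i * (alpha' CARD('k) / CARD('k) * m / m) \<le> p ^ i * (1 - p) ^ (CARD('k) - i)"
      unfolding ck using m by (intro weight_le_bias_power p_def) (simp_all add: k)
    then show "alpha' CARD('k) * real i / CARD('k) \<le> p ^ i * (1 - p) ^ (CARD('k) - i)"
      using m by (simp add: mult_ac)
  qed (use p(1) c in simp)
qed

text \<open>In dimension 2m neither tight weight works alone: weight m has optimal bias 1/2, weight
  m + 1 has (m + 1)/(2m), and \<open>p\<close> lies strictly between. A mixture moves the optimum to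
  \<open>p\<close>.\<close>

lemma csp_alpha_kAND_even:
  assumes k: "CARD('k::finite) = 2 * m" and m: "0 < m"
  shows "csp_alpha (kAND :: bit ^ 'k \<Rightarrow> bit) = ereal (2 * alpha' (CARD('k) + 1))"
proof (rule antisym)
  define c where "c = 2 * alpha' (CARD('k) + 1)"
  define p where "p = (real m + 1) / (2 * real m + 1)"
  \<comment> \<open>the mixing weight for which the derivative of the expectation vanishes at \<open>p\<close>\<close>
  define N where "N = (real m)\<^sup>2 + (real m + 1)\<^sup>2"
  define w where "w = (real m)\<^sup>2 / N"
  define W where "W = map_pmf (\<lambda>x. if x then m + 1 else m) (bernoulli_pmf w)"
  have N: "N > 0"
    using m by (simp add: N_def add_pos_pos)
  have w: "0 \<le> w" "w \<le> 1" "1 - w = (real m + 1)\<^sup>2 / N"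
    using N by (simp_all add: w_def N_def field_simps)
  have p: "p \<in> {0..1}" "1 - p = m / (2 * real m + 1)"
    by (auto simp: p_def field_simps)
  have c': "c = 2 * (p ^ m * (1 - p) ^ m)"
    unfolding c_def k by (simp only: alpha'_odd[OF m p_def])
  \<comment> \<open>Now m/k = 1/2, which cancels the factor 2 in \<open>c\<close>.\<close>
  have ck: "c / CARD('k) * m = p ^ m * (1 - p) ^ (CARD('k) - m)"
    unfolding c' using m by (simp add: k)
  have W: "set_pmf W \<subseteq> {m, m + 1}"
    by (auto simp: W_def)
  \<comment> \<open>Weights m and m + 1 share the factor q^m (1 - q)^(m - 1); what remains is linear
    in \<open>q\<close>.\<close>
  have EW: "measure_pmf.expectation W (\<lambda>i. q ^ i * (1 - q) ^ (CARD('k) - i)) =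
      q ^ m * (1 - q) ^ (m - 1) * ((real m + 1)\<^sup>2 - (2 * real m + 1) * q) / N" for q :: real
  proof -
    have "(1 - q) ^ m = (1 - q) * (1 - q) ^ (m - 1)"
      using m by (simp add: power_eq_if)
    moreover have "CARD('k) - (m + 1) = m - 1" "CARD('k) - m = m"
      using m by (simp_all add: k)
    ultimately have "measure_pmf.expectation W (\<lambda>i. q ^ i * (1 - q) ^ (CARD('k) - i)) =
        q * q ^ m * (1 - q) ^ (m - 1) * w + q ^ m * ((1 - q) * (1 - q) ^ (m - 1)) * (1 - w)"
      unfolding W_def using w(1,2) by simp
    then show ?thesis
      unfolding w(3) unfolding w_def using N by (simp add: field_simps power2_eq_square)
  qed
  have "csp_alpha (kAND :: bit ^ 'k \<Rightarrow> bit) \<le> ereal c"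
  proof (rule csp_alpha_kAND_le[OF p(1), of W])
    show "set_pmf W \<subseteq> {..CARD('k)}"
      using W m by (auto simp: k)
    have "measure_pmf.expectation W real = m + w"
      unfolding W_def using w by (simp add: algebra_simps)
    then show "0 < measure_pmf.expectation W real"
      using m w(1) by simp
  next
    fix i assume "i \<in> set_pmf W"
    then consider "i = m" | "i = m + 1"
      using W by blast
    then show "p ^ i * (1 - p) ^ (CARD('k) - i) = c * real i / CARD('k)"
    proof cases
      case 1
      then show ?thesis
        using ck by simp
    next
      case 2
      have "p ^ i * (1 - p) ^ (CARD('k) - i) = (m + 1) * (c / CARD('k) * m / m)"
        unfolding ck 2 using m by (intro tight_at_consecutive_weights p_def) (auto simp: k)
      then show ?thesis
        using m by (simp add: 2 mult_ac)
    qed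
  next
    fix q :: real assume "q \<in> {0..1}"
    then show "measure_pmf.expectation W (\<lambda>i. q ^ i * (1 - q) ^ (CARD('k) - i)) \<le>
        measure_pmf.expectation W (\<lambda>i. p ^ i * (1 - p) ^ (CARD('k) - i))"
      unfolding EW using N by (intro divide_right_mono bias_power_max_even[OF m _ p_def]) auto
  qed
  then show "csp_alpha (kAND :: bit ^ 'k \<Rightarrow> bit) \<le> ereal (2 * alpha' (CARD('k) + 1))"
    by (simp only: c_def)
  have "ereal c \<le> csp_alpha (kAND :: bit ^ 'k \<Rightarrow> bit)"
  proof (rule csp_alpha_kAND_ge[OF p(1)])
    fix i assume "i \<le> CARD('k)"
    then have "real i * (c / CARD('k) * m / m) \<le> p ^ i * (1 - p) ^ (CARD('k) - i)"
      unfolding ck using m by (intro weight_le_bias_power p_def) (simp_all add: k)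
    then show "c * real i / CARD('k) \<le> p ^ i * (1 - p) ^ (CARD('k) - i)"
      using m by (simp add: mult_ac)
  qed (use p(1) c' in simp)
  then show "ereal (2 * alpha' (CARD('k) + 1)) \<le> csp_alpha (kAND :: bit ^ 'k \<Rightarrow> bit)"
    by (simp only: c_def)
qed

theorem theorem7p1:
  shows "(odd CARD('k::finite) \<and> CARD('k) \<ge> 3 \<longrightarrow>
            csp_alpha (kAND :: bit ^ 'k \<Rightarrow> bit) = ereal (alpha' CARD('k)))
       \<and> (even CARD('k) \<and> CARD('k) \<ge> 2 \<longrightarrow>
            csp_alpha (kAND :: bit ^ 'k \<Rightarrow> bit) = ereal (2 * alpha' (CARD('k) + 1)))"
proof (intro conjI impI; elim conjE)
  assume "odd CARD('k)" "CARD('k) \<ge> 3"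
  then show "csp_alpha (kAND :: bit ^ 'k \<Rightarrow> bit) = ereal (alpha' CARD('k))"
    by (intro csp_alpha_kAND_odd[of "CARD('k) div 2"]) auto
next
  assume "even CARD('k)" "CARD('k) \<ge> 2"
  then show "csp_alpha (kAND :: bit ^ 'k \<Rightarrow> bit) = ereal (2 * alpha' (CARD('k) + 1))"
    by (intro csp_alpha_kAND_even[of "CARD('k) div 2"]) auto
qed

end
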